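(* Let $L$ be a finite-dimensional Leibniz algebra over $\mathbb{C}$ with Levi decomposition $L=R\dot{+}\mathfrak{sl}_2$, where $R$ is the solvable radical of $L$ and $\mathfrak{sl}_2$ is a Levi subalgebra. Let $N$ be the nilradical of $R$, write $R=N\oplus Q$ as vector spaces, and suppose that $R$ is a complete solvable Leibniz algebra with $\dim Q=\dim(N/N^2)$, i.e. the codimension of the nilradical in $R$ equals the number of generators of the nilradical. Then $L=R\oplus\mathfrak{sl}_2$ is a direct sum of ideals; that is, $\mathfrak{sl}_2$ is also a two-sided ideal of $L$.
   Context: All algebras are finite-dimensional over $\mathbb{C}$. A (right) Leibniz algebra is a vector space $L$ with a bilinear product $[-,-]$ satisfying $[x,[y,z]]=[[x,y],z]-[[x,z],y]$ for all $x,y,z\in L$. Ideals are two-sided. Put $L^1=L$, $L^{k+1}=[L^k,L]$ and $L^{[1]}=L$, $L^{[k+1]}=[L^{[k]},L^{[k]}]$; $L$ is nilpotent (respectively solvable) if $L^s=\{0\}$ for some $s$ (respectively $L^{[m]}=\{0\}$ for some $m$). The nilradical (respectively radical) of $L$ is its maximal nilpotent (respectively maximal solvable) ideal. In particular $N^2=[N,N]$, and the number of generators of a nilpotent Leibniz algebra $N$ is $\dim(N/N^2)$. The center is $Z(L)=\{x\in L : [x,y]=[y,x]=0 \text{ for all } y\in L\}$. A derivation is a linear map $d:L\to L$ with $d([x,y])=[d(x),y]+[x,d(y)]$; it is inner if $d=R_x$ for some $x\in L$, where $R_x(y)=[y,x]$. A Leibniz algebra is complete if its center is $\{0\}$ and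 all its derivations are inner. (It is known from earlier work that every solvable Leibniz algebra $R=N\oplus Q$ with nilradical $N$ and $\dim Q=\dim(N/N^2)$ is complete.) The Levi decomposition $L=R\dot{+}S$ means that $L$ is the vector space direct sum of its solvable radical $R$ (an ideal) and a subalgebra $S$ which is a semisimple Lie algebra, called a Levi subalgebra. Here $S$ is isomorphic to the three-dimensional simple Lie algebra $\mathfrak{sl}_2$ over $\mathbb{C}$ and is denoted $\mathfrak{sl}_2$. *)

theory Defs
  imports "HOL-Analysis.Analysis"
begin

locale complex_vector_space = vector_space scale
  for scale :: "complex \<Rightarrow> 'a::ab_group_add \<Rightarrow> 'a"
begin

definition is_direct_sum :: "'a set \<Rightarrow> 'a set \<Rightarrow> 'a set \<Rightarrow> bool" where
  "is_direct_sum W U V \<longleftrightarrow>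
     subspace U \<and> subspace V \<and> W = {u + v | u v. u \<in> U \<and> v \<in> V} \<and> U \<inter> V = {0}"

text \<open>Quotients are handled by representatives: \<open>quotient_basis W U B\<close> says that the cosets
  \<open>b + U\<close>, for \<open>b \<in> B\<close>, are pairwise distinct and form a (finite) basis of \<open>W / U\<close>.\<close>

definition quotient_basis :: "'a set \<Rightarrow> 'a set \<Rightarrow> 'a set \<Rightarrow> bool" where
  "quotient_basis W U B \<longleftrightarrow> finite B \<and> B \<subseteq> W \<and>
     (\<forall>c. (\<Sum>b\<in>B. scale (c b) b) \<in> U \<longrightarrow> (\<forall>b\<in>B. c b = 0)) \<and>
     (\<forall>w\<in>W. \<exists>c. w - (\<Sum>b\<in>B. scale (c b) b) \<in> U)"

definition quotient_dim :: "'a set \<Rightarrow> 'a set \<Rightarrow> nat" where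
  "quotient_dim W U = card (SOME B. quotient_basis W U B)"

lemma quotient_basis_card:
  assumes fin: "finite F" "span F = UNIV"
    and U: "subspace U" and W: "subspace W" and UW: "U \<subseteq> W"
    and B: "quotient_basis W U B"
  shows "card B + dim U = dim W"
proof -
  obtain C where C: "C \<subseteq> U" "independent C" "U \<subseteq> span C" "card C = dim U"
    using basis_exists by metis
  have fC: "finite C" using independent_span_bound[OF fin(1) C(2)] fin(2) by auto
  have spC: "span C = U" using C U by (simp add: span_minimal subset_antisym)
  have fB: "finite B" and BW: "B \<subseteq> W"
    and ind: "\<And>c b. (\<Sum>b\<in>B. scale (c b) b) \<in> U \<Longrightarrow> b \<in> B \<Longrightarrow> c b = 0"
    and gen: "\<And>w. w \<in> W \<Longrightarrow> \<exists>c. w - (\<Sum>b\<in>B. scale (c b) b) \<in> U"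
    using B unfolding quotient_basis_def by blast+
  have disj: "B \<inter> C = {}"
  proof (rule ccontr)
    assume "B \<inter> C \<noteq> {}"
    then obtain x where x: "x \<in> B" "x \<in> C" by blast
    have "(\<Sum>b\<in>B. scale (if b = x then 1 else 0) b) = x"
      using fB x by (simp add: if_distrib[of "\<lambda>c. scale c _"] cong: if_cong)
    then have "(1::complex) = 0"
      using ind[of "\<lambda>b. if b = x then 1 else 0" x] x C(1) by auto
    then show False by simp
  qed
  have "independent (B \<union> C)"
  proof
    assume "dependent (B \<union> C)"
    then obtain c where c0: "\<exists>v\<in>B \<union> C. c v \<noteq> 0" and s: "(\<Sum>v\<in>B \<union> C. scale (c v) v) = 0"
      using dependent_finite[of "B \<union> C"] fB fC by auto
    have s': "(\<Sum>v\<in>B. scale (c v) v) + (\<Sum>v\<in>C. scale (c v) v) = 0"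
      using s disj fB fC by (simp add: sum.union_disjoint)
    have "(\<Sum>v\<in>C. scale (c v) v) \<in> U"
      using C(1) U by (auto intro!: subspace_sum subspace_scale)
    then have "(\<Sum>v\<in>B. scale (c v) v) \<in> U"
      using s' subspace_neg[OF U] by (metis eq_neg_iff_add_eq_0)
    then have b0: "\<forall>v\<in>B. c v = 0" using ind by blast
    then have "(\<Sum>v\<in>C. scale (c v) v) = 0" using s' by simp
    then have "\<forall>v\<in>C. c v = 0" using C(2) dependent_finite[OF fC] by blast
    then show False using b0 c0 by blast
  qed
  moreover have "B \<union> C \<subseteq> W" using BW C(1) UW by blast
  moreover have "W \<subseteq> span (B \<union> C)"
  proof
    fix w assume "w \<in> W"
    then obtain c where "w - (\<Sum>b\<in>B. scale (c b) b) \<in> span C" using gen spC by blast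
    then have "w - (\<Sum>b\<in>B. scale (c b) b) \<in> span (B \<union> C)" using span_mono[of C "B \<union> C"] by blast
    moreover have "(\<Sum>b\<in>B. scale (c b) b) \<in> span (B \<union> C)"
      by (intro span_sum span_scale span_base) blast
    ultimately show "w \<in> span (B \<union> C)" by (metis diff_add_cancel span_add)
  qed
  ultimately have "card (B \<union> C) = dim W" using basis_card_eq_dim by blast
  then show ?thesis using disj fB fC C(4) by (simp add: card_Un_disjoint)
qed

lemma quotient_basis_exists:
  assumes fin: "finite F" "span F = UNIV"
    and U: "subspace U" and W: "subspace W" and UW: "U \<subseteq> W"
  shows "\<exists>B. quotient_basis W U B"
proof -
  obtain C where C: "C \<subseteq> U" "independent C" "U \<subseteq> span C"
    using basis_exists by metis
  have spC: "span C = U" using C U by (simp add: span_minimal subset_antisym)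
  obtain D where D: "C \<subseteq> D" "D \<subseteq> W" "independent D" "W \<subseteq> span D"
    using maximal_independent_subset_extend[of C W] C UW by blast
  have fD: "finite D" using independent_span_bound[OF fin(1) D(3)] fin(2) by auto
  have fC: "finite C" using fD D(1) finite_subset by blast
  have split: "(\<Sum>v\<in>D. scale (c v) v) = (\<Sum>v\<in>D - C. scale (c v) v) + (\<Sum>v\<in>C. scale (c v) v)" for c
    using sum.subset_diff[OF D(1) fD] .
  have "quotient_basis W U (D - C)"
    unfolding quotient_basis_def
  proof (intro conjI allI impI ballI)
    show "finite (D - C)" "D - C \<subseteq> W" using fD D(2) by auto
  next
    fix c b assume s: "(\<Sum>b\<in>D - C. scale (c b) b) \<in> U" and b: "b \<in> D - C"
    then obtain e where e: "(\<Sum>b\<in>D - C. scale (c b) b) = (\<Sum>v\<in>C. scale (e v) v)"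
      unfolding spC[symmetric] span_finite[OF fC] by blast
    let ?c = "\<lambda>v. if v \<in> C then - e v else c v"
    have "(\<Sum>v\<in>D. scale (?c v) v) = 0"
      unfolding split using e by (simp add: sum_negf)
    moreover have "b \<in> D" using b by simp
    ultimately have "?c b = 0" by (intro independentD[OF D(3) fD order_refl])
    then show "c b = 0" using b by simp
  next
    fix w assume "w \<in> W"
    then obtain c where "w = (\<Sum>v\<in>D. scale (c v) v)"
      using D(4) unfolding span_finite[OF fD] by blast
    then have "w - (\<Sum>b\<in>D - C. scale (c b) b) = (\<Sum>v\<in>C. scale (c v) v)"
      by (simp add: split)
    moreover have "(\<Sum>v\<in>C. scale (c v) v) \<in> U"
      using C(1) U by (auto intro!: subspace_sum subspace_scale)
    ultimately show "\<exists>c. w - (\<Sum>b\<in>D - C. scale (c b) b) \<in> U" by metis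
  qed
  then show ?thesis by blast
qed

lemma quotient_dim_eq:
  assumes "finite F" "span F = UNIV" "subspace U" "subspace W" "U \<subseteq> W"
  shows "quotient_dim W U + dim U = dim W"
  unfolding quotient_dim_def
  using quotient_basis_card[OF assms] someI_ex[OF quotient_basis_exists[OF assms]] by blast

end

text \<open>The bracket of the right Leibniz algebra is \<open>br\<close>, and the algebra is the whole type.
  Its subalgebras are subsets, so every notion below takes the algebra \<open>A\<close> it refers to as a
  set; the notions for the whole algebra are obtained with \<open>A = UNIV\<close>.\<close>

locale leibniz_algebra = complex_vector_space scale
  for scale :: "complex \<Rightarrow> 'a::ab_group_add \<Rightarrow> 'a" +
  fixes br :: "'a \<Rightarrow> 'a \<Rightarrow> 'a"
  assumes br_linear_right: "Vector_Spaces.linear scale scale (\<lambda>y. br x y)"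
    and br_linear_left: "Vector_Spaces.linear scale scale (\<lambda>x. br x y)"
    and leibniz_identity: "br x (br y z) = br (br x y) z - br (br x z) y"
begin

definition subalgebra :: "'a set \<Rightarrow> bool" where
  "subalgebra A \<longleftrightarrow> subspace A \<and> (\<forall>x\<in>A. \<forall>y\<in>A. br x y \<in> A)"

definition is_ideal :: "'a set \<Rightarrow> 'a set \<Rightarrow> bool" where
  "is_ideal A J \<longleftrightarrow> subspace J \<and> J \<subseteq> A \<and> (\<forall>x\<in>A. \<forall>y\<in>J. br x y \<in> J \<and> br y x \<in> J)"

definition product_space :: "'a set \<Rightarrow> 'a set \<Rightarrow> 'a set" where
  "product_space A B = span {br x y | x y. x \<in> A \<and> y \<in> B}"

text \<open>Both series are indexed from 0: the \<open>k\<close>-th members are \<open>A\<close> to the power \<open>k + 1\<close> and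
  \<open>[k + 1]\<close>, respectively.\<close>

primrec lower_series :: "'a set \<Rightarrow> nat \<Rightarrow> 'a set" where
  "lower_series A 0 = A"
| "lower_series A (Suc k) = product_space (lower_series A k) A"

primrec derived_series :: "'a set \<Rightarrow> nat \<Rightarrow> 'a set" where
  "derived_series A 0 = A"
| "derived_series A (Suc k) = product_space (derived_series A k) (derived_series A k)"

definition is_nilpotent :: "'a set \<Rightarrow> bool" where
  "is_nilpotent A \<longleftrightarrow> (\<exists>s. lower_series A s = {0})"

definition is_solvable :: "'a set \<Rightarrow> bool" where
  "is_solvable A \<longleftrightarrow> (\<exists>m. derived_series A m = {0})"

definition is_nilradical :: "'a set \<Rightarrow> 'a set \<Rightarrow> bool" where
  "is_nilradical A N \<longleftrightarrow> is_ideal A N \<and> is_nilpotent N \<and>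
     (\<forall>J. is_ideal A J \<longrightarrow> is_nilpotent J \<longrightarrow> N \<subseteq> J \<longrightarrow> J = N)"

definition is_radical :: "'a set \<Rightarrow> 'a set \<Rightarrow> bool" where
  "is_radical A R \<longleftrightarrow> is_ideal A R \<and> is_solvable R \<and>
     (\<forall>J. is_ideal A J \<longrightarrow> is_solvable J \<longrightarrow> R \<subseteq> J \<longrightarrow> J = R)"

definition center :: "'a set \<Rightarrow> 'a set" where
  "center A = {x\<in>A. \<forall>y\<in>A. br x y = 0 \<and> br y x = 0}"

text \<open>Only the values of \<open>d\<close> on \<open>A\<close> matter here.\<close>

definition derivation :: "'a set \<Rightarrow> ('a \<Rightarrow> 'a) \<Rightarrow> bool" where
  "derivation A d \<longleftrightarrow> (\<forall>x\<in>A. d x \<in> A) \<and>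
     (\<forall>x\<in>A. \<forall>y\<in>A. d (x + y) = d x + d y) \<and>
     (\<forall>c. \<forall>x\<in>A. d (scale c x) = scale c (d x)) \<and>
     (\<forall>x\<in>A. \<forall>y\<in>A. d (br x y) = br (d x) y + br x (d y))"

definition inner_derivation :: "'a set \<Rightarrow> ('a \<Rightarrow> 'a) \<Rightarrow> bool" where
  "inner_derivation A d \<longleftrightarrow> (\<exists>x\<in>A. \<forall>y\<in>A. d y = br y x)"

definition is_complete :: "'a set \<Rightarrow> bool" where
  "is_complete A \<longleftrightarrow> center A = {0} \<and> (\<forall>d. derivation A d \<longrightarrow> inner_derivation A d)"

text \<open>A Leibniz algebra with alternating bracket is a Lie algebra: the Leibniz identity then
  becomes the Jacobi identity.\<close>

definition semisimple_lie :: "'a set \<Rightarrow> bool" where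
  "semisimple_lie A \<longleftrightarrow> subalgebra A \<and> (\<forall>x\<in>A. br x x = 0) \<and> is_radical A {0}"

definition levi_decomposition :: "'a set \<Rightarrow> 'a set \<Rightarrow> 'a set \<Rightarrow> bool" where
  "levi_decomposition A R S \<longleftrightarrow> is_radical A R \<and> semisimple_lie S \<and> is_direct_sum A R S"

definition isomorphic_sl2 :: "'a set \<Rightarrow> bool" where
  "isomorphic_sl2 A \<longleftrightarrow> (\<exists>f :: 'a \<Rightarrow> complex^2^2.
     bij_betw f A {M. trace M = 0} \<and>
     (\<forall>x\<in>A. \<forall>y\<in>A. f (x + y) = f x + f y) \<and>
     (\<forall>c. \<forall>x\<in>A. f (scale c x) = (\<chi> i j. c * f x $ i $ j)) \<and>
     (\<forall>x\<in>A. \<forall>y\<in>A. f (br x y) = f x ** f y - f y ** f x))"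

definition direct_sum_of_ideals :: "'a set \<Rightarrow> 'a set \<Rightarrow> 'a set \<Rightarrow> bool" where
  "direct_sum_of_ideals A I J \<longleftrightarrow> is_ideal A I \<and> is_ideal A J \<and> is_direct_sum A I J"

end

locale fin_dim_leibniz_algebra = leibniz_algebra +
  assumes finite_dimensional: "\<exists>B. finite B \<and> span B = UNIV"

end

theory Submission
  imports Defs
begin

text \<open>Right multiplications by \<open>S\<close> are derivations of \<open>R\<close>, hence inner. Since \<open>S\<close> is perfect, they
  can be represented by elements arbitrarily deep in the derived series of \<open>R\<close>, so \<open>[R, S] = 0\<close> by
  solvability. The Leibniz identity then gives \<open>[[S, S], R] = 0\<close>, that is, \<open>[S, R] = 0\<close>.\<close>

text \<open>A fixed number of commutators lets perfectness of sl2 be used without spans or sums of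
  variable length.\<close>

lemma trace_zero_2_commutators:
  fixes M :: "complex^2^2"
  assumes "trace M = 0"
  obtains A B C D :: "complex^2^2" where
    "trace A = 0" "trace B = 0" "trace C = 0" "trace D = 0"
    "M = (A ** B - B ** A) + (C ** D - D ** C)"
proof
  \<comment> \<open>In the standard basis, \<open>mk a b c\<close> is a h + b e + c f. As [e, f] =
    h, the first commutator supplies the diagonal of \<open>M\<close>. As [h, e] = 2e and [h, f] =
    -2f, the second supplies the off-diagonal part, whence the halves and the sign.\<close>
  define mk :: "complex \<Rightarrow> complex \<Rightarrow> complex \<Rightarrow> complex^2^2"
    where "mk a b c = vector [vector [a, b], vector [c, - a]]" for a b c
  show "trace (mk 0 (M$1$1) 0) = 0" "trace (mk 0 0 1) = 0" "trace (mk 1 0 0) = 0"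
    "trace (mk 0 (M$1$2 / 2) (- (M$2$1) / 2)) = 0"
    by (simp_all add: mk_def trace_def sum_2)
  have "M$2$2 = - M$1$1"
    using assms by (simp add: trace_def sum_2 add_eq_0_iff)
  then show "M = (mk 0 (M$1$1) 0 ** mk 0 0 1 - mk 0 0 1 ** mk 0 (M$1$1) 0)
    + (mk 1 0 0 ** mk 0 (M$1$2 / 2) (- (M$2$1) / 2) - mk 0 (M$1$2 / 2) (- (M$2$1) / 2) ** mk 1 0 0)"
    by (simp add: mk_def matrix_matrix_mult_def vec_eq_iff forall_2 sum_2)
qed

context leibniz_algebra
begin

lemma br_add_right: "br x (y + z) = br x y + br x z"
  using br_linear_right[of x] by (simp add: Vector_Spaces.linear_iff)

lemma br_add_left: "br (x + y) z = br x z + br y z"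
  using br_linear_left[of z] by (simp add: Vector_Spaces.linear_iff)

lemma br_scale_left: "br (scale c x) z = scale c (br x z)"
  using br_linear_left[of z] by (simp add: Vector_Spaces.linear_iff)

lemma br_zero_right: "br x 0 = 0"
  using br_add_right[of x 0 0] by simp

text \<open>Pulls the matrix decomposition back along the isomorphism.\<close>

lemma isomorphic_sl2_commutators:
  assumes "isomorphic_sl2 S" "subalgebra S" "s \<in> S"
  obtains p q u v where "p \<in> S" "q \<in> S" "u \<in> S" "v \<in> S" "s = br p q + br u v"
proof -
  from assms(1) obtain f :: "'a \<Rightarrow> complex^2^2" where
    bij: "bij_betw f S {M. trace M = 0}" and
    add: "\<And>x y. x \<in> S \<Longrightarrow> y \<in> S \<Longrightarrow> f (x + y) = f x + f y" and
    br: "\<And>x y. x \<in> S \<Longrightarrow> y \<in> S \<Longrightarrow> f (br x y) = f x ** f y - f y ** f x"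
    unfolding isomorphic_sl2_def by blast
  have "trace (f s) = 0" using bij assms(3) by (auto simp: bij_betw_def)
  then obtain A B C D where tr: "trace A = 0" "trace B = 0" "trace C = 0" "trace D = 0"
    and fs: "f s = (A ** B - B ** A) + (C ** D - D ** C)"
    by (rule trace_zero_2_commutators)
  have surj: "\<exists>x\<in>S. f x = M" if "trace M = 0" for M
  proof -
    have "M \<in> f ` S" using bij_betw_imp_surj_on[OF bij] that by simp
    then show ?thesis by blast
  qed
  obtain p q u v where S: "p \<in> S" "q \<in> S" "u \<in> S" "v \<in> S"
    and f: "f p = A" "f q = B" "f u = C" "f v = D"
    using surj tr by metis
  \<comment> \<open>The map \<open>f\<close> is additive and injective only on \<open>S\<close>, so
    every term has to stay there.\<close>
  have closed: "br p q \<in> S" "br u v \<in> S" "br p q + br u v \<in> S"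
    using assms(2) S by (auto simp: subalgebra_def intro: subspace_add)
  have "f s = f (br p q + br u v)" using fs f S closed by (simp add: add br)
  then have "s = br p q + br u v"
    using bij assms(3) closed by (auto simp: bij_betw_def dest: inj_onD)
  then show thesis using that S by blast
qed

text \<open>The right Leibniz identity, solved for [[x, y], s], is the product rule;
  \<open>R\<close> being an ideal keeps the values in \<open>R\<close>.\<close>

lemma right_mult_derivation:
  assumes "is_ideal UNIV R"
  shows "derivation R (\<lambda>x. br x s)"
  using assms leibniz_identity
  by (auto simp: derivation_def is_ideal_def br_add_left br_scale_left)

text \<open>If a and b represent p and q on \<open>R\<close>, then [a, b] represents [p, q] and lies
  one step deeper. Perfectness reduces each s to such brackets, so the induction must range over all
  of \<open>S\<close>.\<close>

lemma right_mult_in_derived_series: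
  assumes R: "is_ideal UNIV R"
    and inner: "\<forall>d. derivation R d \<longrightarrow> inner_derivation R d"
    and perfect: "\<forall>s\<in>S. \<exists>p\<in>S. \<exists>q\<in>S. \<exists>u\<in>S. \<exists>v\<in>S. s = br p q + br u v"
    and "s \<in> S"
  shows "\<exists>x\<in>derived_series R k. \<forall>y\<in>R. br y s = br y x"
  using \<open>s \<in> S\<close>
proof (induction k arbitrary: s)
  \<comment> \<open>The series starts at \<open>R\<close> itself, so this is innerness.\<close>
  case 0
  then show ?case
    using inner right_mult_derivation[OF R, of s] by (simp add: inner_derivation_def)
next
  case (Suc k)
  have commutator: "\<exists>x\<in>derived_series R (Suc k). \<forall>y\<in>R. br y (br p q) = br y x"
    if "p \<in> S" "q \<in> S" for p q
  proof -
    obtain a where a: "a \<in> derived_series R k" "\<And>y. y \<in> R \<Longrightarrow> br y p = br y a"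
      using Suc.IH[OF \<open>p \<in> S\<close>] by blast
    obtain b where b: "b \<in> derived_series R k" "\<And>y. y \<in> R \<Longrightarrow> br y q = br y b"
      using Suc.IH[OF \<open>q \<in> S\<close>] by blast
    \<comment> \<open>Expand to [[y, p], q] - [[y, q], p]. The inner brackets stay in
      \<open>R\<close>, so p and q may be replaced one at a time.\<close>
    have "br y (br p q) = br y (br a b)" if "y \<in> R" for y
    proof -
      have "br y p \<in> R" "br y q \<in> R" using R that by (auto simp: is_ideal_def)
      then show ?thesis using a b that by (simp add: leibniz_identity)
    qed
    moreover have "br a b \<in> derived_series R (Suc k)"
      using a b by (auto simp: product_space_def intro: span_base)
    ultimately show ?thesis by blast
  qed
  obtain p q u v where S: "p \<in> S" "q \<in> S" "u \<in> S" "v \<in> S" and s: "s = br p q + br u v"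
    using perfect Suc.prems by blast
  obtain x where x: "x \<in> derived_series R (Suc k)" "\<forall>y\<in>R. br y (br p q) = br y x"
    using commutator S by blast
  obtain x' where x': "x' \<in> derived_series R (Suc k)" "\<forall>y\<in>R. br y (br u v) = br y x'"
    using commutator S by blast
  have "x + x' \<in> derived_series R (Suc k)"
    using x x' by (simp add: product_space_def span_add)
  moreover have "\<forall>y\<in>R. br y s = br y (x + x')"
    using x x' by (simp add: s br_add_right)
  ultimately show ?case by blast
qed

lemma direct_sum_of_ideals_perfect:
  assumes R: "is_ideal UNIV R" and "is_solvable R"
    and inner: "\<forall>d. derivation R d \<longrightarrow> inner_derivation R d"
    and S: "subalgebra S" and sum: "is_direct_sum UNIV R S"
    and perfect: "\<forall>s\<in>S. \<exists>p\<in>S. \<exists>q\<in>S. \<exists>u\<in>S. \<exists>v\<in>S. s = br p q + br u v"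
  shows "direct_sum_of_ideals UNIV R S"
proof -
  obtain m where m: "derived_series R m = {0}"
    using \<open>is_solvable R\<close> by (auto simp: is_solvable_def)
  \<comment> \<open>At depth \<open>m\<close> the only available representative is 0.\<close>
  have RS: "br r s = 0" if "r \<in> R" "s \<in> S" for r s
    using right_mult_in_derived_series[OF R inner perfect \<open>s \<in> S\<close>, of m] m \<open>r \<in> R\<close>
    by (simp add: br_zero_right)
  \<comment> \<open>Without anticommutativity the other side needs its own argument. In [s, [r, t]]
    = [[s, r], t] - [[s, t], r] the first two terms vanish by \<open>RS\<close>, since [s, r] is in
    \<open>R\<close>.\<close>
  have "br (br s t) r = 0" if "s \<in> S" "t \<in> S" "r \<in> R" for s t r
  proof -
    have "br s r \<in> R" using R that by (auto simp: is_ideal_def)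
    then show ?thesis
      using leibniz_identity[of s r t] RS that by (simp add: br_zero_right)
  qed
  then have SR: "br s r = 0" if "s \<in> S" "r \<in> R" for s r
    using bspec[OF perfect \<open>s \<in> S\<close>] \<open>r \<in> R\<close> by (auto simp: br_add_left)
  \<comment> \<open>Split x along \<open>R\<close> and \<open>S\<close>: only the bracket inside
    \<open>S\<close> survives.\<close>
  have "br x t \<in> S \<and> br t x \<in> S" if "t \<in> S" for x t
  proof -
    obtain r s where "x = r + s" "r \<in> R" "s \<in> S"
      using sum unfolding is_direct_sum_def by blast
    then show ?thesis
      using S that by (simp add: br_add_left br_add_right RS SR subalgebra_def)
  qed
  then have "is_ideal UNIV S" using S by (simp add: is_ideal_def subalgebra_def)
  then show ?thesis using R sum by (simp add: direct_sum_of_ideals_def)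
qed

end

theorem theorem3p4:
  fixes scale :: "complex \<Rightarrow> 'a::ab_group_add \<Rightarrow> 'a"
    and br :: "'a \<Rightarrow> 'a \<Rightarrow> 'a"
    and R S N Q :: "'a set"
  assumes "fin_dim_leibniz_algebra scale br"
    and "leibniz_algebra.levi_decomposition scale br UNIV R S"
    and "leibniz_algebra.isomorphic_sl2 scale br S"
    and "leibniz_algebra.is_nilradical scale br R N"
    and "complex_vector_space.is_direct_sum scale R N Q"
    and "leibniz_algebra.is_solvable scale br R"
    and "leibniz_algebra.is_complete scale br R"
    and "vector_space.dim scale Q =
           complex_vector_space.quotient_dim scale N (leibniz_algebra.product_space scale br N N)"
  shows "leibniz_algebra.direct_sum_of_ideals scale br UNIV R S"
proof -
  interpret fin_dim_leibniz_algebra scale br by (fact assms(1))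
  have R: "is_ideal UNIV R" and S: "subalgebra S" and sum: "is_direct_sum UNIV R S"
    using assms(2) by (auto simp: levi_decomposition_def is_radical_def semisimple_lie_def)
  have inner: "\<forall>d. derivation R d \<longrightarrow> inner_derivation R d"
    using assms(7) by (auto simp: is_complete_def)
  have "\<forall>s\<in>S. \<exists>p\<in>S. \<exists>q\<in>S. \<exists>u\<in>S. \<exists>v\<in>S. s = br p q + br u v"
    using isomorphic_sl2_commutators[OF assms(3) S] by metis
  then show ?thesis
    by (rule direct_sum_of_ideals_perfect[OF R assms(6) inner S sum])
qed

end
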